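(* For every integer $k\geq 4$ there exists a tree $T$ of order $2k+1$, and for every integer $k\geq 3$ there exists a tree $T$ of order $2k+4$, each satisfying the following conditions: (1) $h(T)\geq \frac{n(T)}{2}$; (2) each $S\in\Omega(T)$ is a maximal annihilating set that is not a maximum annihilating set.
   Context: Graphs are finite, undirected, without loops or multiple edges. $n(G)=|V(G)|$ is the order and $m(G)=|E(G)|$. $\Omega(G)$ is the family of all maximum independent sets of $G$ (independent sets of maximum cardinality). If $d_1\leq d_2\leq\cdots\leq d_n$ is the degree sequence of $G$, the annihilation number $h(G)$ is the largest integer $k$ (with $0\le k\le n$) such that $\sum_{i=1}^{k} d_i\leq m(G)$. For $A\subseteq V(G)$ let $\deg(A)=\sum_{v\in A}\deg(v)$. A set $A\subseteq V(G)$ is an annihilating set if $\deg(A)\leq m(G)$; an annihilating set $A$ is maximal if $\deg(A\cup\{v\})>m(G)$ for every $v\in V(G)-A$, and it is maximum if $|A|=h(G)$. *)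

theory Defs
  imports
    Complex_Main
    "HOL-Library.Multiset"
    "Graph_Theory.Graph_Theory"
begin

text \<open>
  Finite simple graphs are the locale \<^locale>\<open>pair_graph\<close>: a finite vertex set with a finite,
  symmetric, irreflexive set of arcs, so that every undirected edge \<open>{u, v}\<close> is represented by the
  two arcs \<open>(u, v)\<close> and \<open>(v, u)\<close>.
\<close>

definition edges :: "'a pair_pre_digraph \<Rightarrow> 'a set set" where
  "edges G = {{u, v} | u v. (u, v) \<in> parcs G}"

definition graph_order :: "'a pair_pre_digraph \<Rightarrow> nat" where
  "graph_order G = card (pverts G)"

definition graph_size :: "'a pair_pre_digraph \<Rightarrow> nat" where
  "graph_size G = card (edges G)"

definition degree :: "'a pair_pre_digraph \<Rightarrow> 'a \<Rightarrow> nat" where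
  "degree G v = card {e \<in> edges G. v \<in> e}"

text \<open>
  The library's own \<^const>\<open>tree\<close> is about directed cycles: in a symmetric digraph \<open>u, v, u\<close> is
  a cycle for every edge \<open>{u, v}\<close>. The cycles of an undirected graph are the cycles of
  length at least 3.
\<close>

definition undirected_tree :: "'a pair_pre_digraph \<Rightarrow> bool" where
  "undirected_tree G \<longleftrightarrow>
     pair_graph G \<and>
     Digraph_Component.connected (with_proj G) \<and>
     \<not> (\<exists>p. pre_digraph.cycle (with_proj G) p \<and> length p \<ge> 3)"

definition independent_set :: "'a pair_pre_digraph \<Rightarrow> 'a set \<Rightarrow> bool" where
  "independent_set G A \<longleftrightarrow> A \<subseteq> pverts G \<and> (\<forall>u\<in>A. \<forall>v\<in>A. (u, v) \<notin> parcs G)"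

definition max_independent_sets :: "'a pair_pre_digraph \<Rightarrow> 'a set set" where
  "max_independent_sets G =
     {S. independent_set G S \<and> (\<forall>A. independent_set G A \<longrightarrow> card A \<le> card S)}"

definition degree_sequence :: "'a pair_pre_digraph \<Rightarrow> nat list" where
  "degree_sequence G = sorted_list_of_multiset (image_mset (degree G) (mset_set (pverts G)))"

definition annihilation_number :: "'a pair_pre_digraph \<Rightarrow> nat" where
  "annihilation_number G =
     Max {k. k \<le> graph_order G \<and> sum_list (take k (degree_sequence G)) \<le> graph_size G}"

definition degree_sum :: "'a pair_pre_digraph \<Rightarrow> 'a set \<Rightarrow> nat" where
  "degree_sum G A = (\<Sum>v\<in>A. degree G v)"

definition annihilating_set :: "'a pair_pre_digraph \<Rightarrow> 'a set \<Rightarrow> bool" where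
  "annihilating_set G A \<longleftrightarrow> A \<subseteq> pverts G \<and> degree_sum G A \<le> graph_size G"

definition maximal_annihilating_set :: "'a pair_pre_digraph \<Rightarrow> 'a set \<Rightarrow> bool" where
  "maximal_annihilating_set G A \<longleftrightarrow>
     annihilating_set G A \<and> (\<forall>v \<in> pverts G - A. degree_sum G (A \<union> {v}) > graph_size G)"

definition maximum_annihilating_set :: "'a pair_pre_digraph \<Rightarrow> 'a set \<Rightarrow> bool" where
  "maximum_annihilating_set G A \<longleftrightarrow>
     annihilating_set G A \<and> card A = annihilation_number G"

end

theory Submission
  imports Defs
begin

text \<open>
  Each tree is a spider: a centre \<open>c\<close> with \<open>r \<ge> 4\<close> legs of length two, where one
  of the middle vertices may carry \<open>t\<close> additional leaves. It has \<open>2r + 1 + t\<close> vertices,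
  hence \<open>2r + t\<close> edges.

  The set \<open>S\<close> consisting of \<open>c\<close> and the \<open>r + t\<close> leaves is the unique maximum independent set,
  because an independent set that uses middle vertices loses \<open>c\<close> and, for every middle vertex, at
  least one leaf (\<open>spider_max_independent\<close>). As \<open>S\<close> is a side of the bipartition, every edge has
  exactly one endpoint in it, so its degree sum is exactly the number of edges; since there are no
  isolated vertices, \<open>S\<close> is a maximal annihilating set.

  However, \<open>c\<close> spends degree \<open>r\<close>, which would also pay for two middle vertices of degree 2. Trading
  \<open>c\<close> for two such vertices keeps the set annihilating precisely because \<open>r \<ge> 4\<close>, and it gains one
  vertex. An annihilating set never has more vertices than the annihilation number
  (\<open>annihilating_set_card_le\<close>), so \<open>r + t + 2\<close> is a lower bound for the latter, which exceeds the
  size of \<open>S\<close> and is at least half of the order.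

  The cases \<open>t = 0\<close> and \<open>t = 1\<close> give the odd and the even orders.
\<close>

section \<open>Annihilating sets and the annihilation number\<close>

text \<open>
  Comparing with the first entry \<open>x\<close> of the sorted list: either \<open>x\<close> is one of the selected
  entries, or any selected entry may be exchanged for it without increasing the sum.
\<close>

lemma sum_list_take_sorted_le:
  fixes xs :: "'a :: {canonically_ordered_monoid_add, linorder} list"
  assumes "sorted xs" and "N \<subseteq># mset xs"
  shows "sum_list (take (size N) xs) \<le> sum_mset N"
  using assms
proof (induction xs arbitrary: N)
  case Nil
  then show ?case by simp
next
  case (Cons x xs)
  show ?case
  proof (cases "N = {#}")
    case False
    obtain y where y: "y \<in># N" "x \<le> y" "N - {#y#} \<subseteq># mset xs"
    proof (cases "x \<in># N")
      case True
      have "N - {#x#} \<subseteq># mset xs"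
        using Cons.prems(2) by (simp add: subset_eq_diff_conv)
      with True that show ?thesis by blast
    next
      case False
      have sub: "N \<subseteq># mset xs"
      proof (intro mset_subset_eqI)
        fix a
        show "count N a \<le> count (mset xs) a"
          using mset_subset_eq_count[OF Cons.prems(2), of a] False
          by (cases "a = x") (simp_all add: not_in_iff)
      qed
      obtain y where "y \<in># N" using \<open>N \<noteq> {#}\<close> by blast
      moreover have "x \<le> y"
        using mset_subset_eqD[OF sub calculation] Cons.prems(1) by simp
      moreover have "N - {#y#} \<subseteq># mset xs"
        using subset_mset.order_trans[OF diff_subset_eq_self sub] .
      ultimately show ?thesis using that by blast
    qed
    define M where "M = N - {#y#}"
    have N: "N = add_mset y M" using y(1) by (simp add: M_def)
    have "sum_list (take (size M) xs) \<le> sum_mset M"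
      using Cons.IH[of M] Cons.prems(1) y(3) by (simp add: M_def)
    with y(2) show ?thesis by (simp add: N add_mono)
  qed simp
qed

text \<open>The annihilation number is the maximum size of an annihilating set; this is the half that
  bounds it from below.\<close>

lemma annihilating_set_card_le:
  assumes "finite (pverts G)" and "annihilating_set G A"
  shows "card A \<le> annihilation_number G"
proof -
  have A: "A \<subseteq> pverts G" "degree_sum G A \<le> graph_size G"
    using assms(2) by (auto simp: annihilating_set_def)
  define N where "N = image_mset (degree G) (mset_set A)"
  have "N \<subseteq># mset (degree_sequence G)"
    using assms(1) A(1)
    by (simp add: N_def degree_sequence_def image_mset_subseteq_mono subset_imp_msubset_mset_set)
  then have "sum_list (take (size N) (degree_sequence G)) \<le> sum_mset N"
    by (intro sum_list_take_sorted_le) (simp_all add: degree_sequence_def)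
  also have "sum_mset N = degree_sum G A"
    by (simp add: N_def degree_sum_def sum_unfold_sum_mset)
  finally have "sum_list (take (card A) (degree_sequence G)) \<le> graph_size G"
    using A(2) by (simp add: N_def)
  moreover have "card A \<le> graph_order G"
    using assms(1) A(1) by (simp add: graph_order_def card_mono)
  ultimately show ?thesis
    unfolding annihilation_number_def by (intro Max_ge) auto
qed

section \<open>Trees from parent functions\<close>

text \<open>
  If every \<open>par j\<close> is smaller than \<open>j\<close>, this is a tree with root \<open>0\<close> whose labels increase away
  from the root. Each edge is then named by its larger endpoint, so edges and degrees can be
  counted on indices.
\<close>

definition parent_graph :: "nat \<Rightarrow> (nat \<Rightarrow> nat) \<Rightarrow> nat pair_pre_digraph" where
  "parent_graph n par = \<lparr> pverts = {..<n},
     parcs = (\<Union>j\<in>{0<..<n}. {(j, par j), (par j, j)}) \<rparr>"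

lemma pcas_nth_Suc:
  assumes "pcas u w v" and "Suc i < length w"
  shows "fst (w ! Suc i) = snd (w ! i)"
  using assms
proof (induction w arbitrary: u i)
  case (Cons e w)
  then show ?case by (cases w; cases i) auto
qed simp

lemma pcas_hd_last:
  assumes "pcas u w v" and "w \<noteq> []"
  shows "fst (hd w) = u" and "snd (last w) = v"
  using assms by (induction w arbitrary: u) auto

lemma pcas_closed_nth:
  assumes "pcas u w u" and "i < length w"
  shows "fst (w ! (Suc i mod length w)) = snd (w ! i)"
proof (cases "Suc i < length w")
  case True
  then show ?thesis using pcas_nth_Suc[OF assms(1)] by simp
next
  case False
  with assms(2) have i: "Suc i = length w" "w \<noteq> []" by auto
  then have "snd (w ! i) = snd (last w)" by (metis last_conv_nth diff_Suc_1)
  then show ?thesis using i pcas_hd_last[OF assms(1) i(2)] by (simp add: hd_conv_nth)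
qed

locale parent_function =
  fixes n :: nat and par :: "nat \<Rightarrow> nat"
  assumes order_pos: "0 < n"
    and parent_less: "0 < j \<Longrightarrow> j < n \<Longrightarrow> par j < j"
begin

abbreviation "G \<equiv> parent_graph n par"

lemma pverts_G [simp]: "pverts G = {..<n}"
  by (simp add: parent_graph_def)

lemma parcs_G_iff:
  "(u, v) \<in> parcs G \<longleftrightarrow> (0 < u \<and> u < n \<and> v = par u) \<or> (0 < v \<and> v < n \<and> u = par v)"
  by (auto simp: parent_graph_def)

lemma pair_graph_G: "pair_graph G"
proof
  show "finite (parcs G)" by (simp add: parent_graph_def)
  show "symmetric (with_proj G)"
    by (auto simp: symmetric_def sym_def parcs_G_iff)
  fix e assume e: "e \<in> parcs G"
  then obtain j where j: "0 < j" "j < n" "e = (j, par j) \<or> e = (par j, j)"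
    by (auto simp: parent_graph_def)
  with parent_less[OF j(1,2)] show "fst e \<in> pverts G" "snd e \<in> pverts G" "fst e \<noteq> snd e"
    by auto
qed simp

lemma connected_G: "Digraph_Component.connected (with_proj G)"
proof -
  interpret pair_graph G by (rule pair_graph_G)
  have sym: "symmetric (with_proj G)" by (rule pair_sym_arcs)
  have root: "j \<rightarrow>\<^sup>*\<^bsub>with_proj G\<^esub> 0" if "j < n" for j
    using that
  proof (induction j rule: less_induct)
    case (less j)
    show ?case
    proof (cases "j = 0")
      case True
      then show ?thesis using less.prems by auto
    next
      case False
      then have "par j < j" using less.prems parent_less by simp
      then have "par j \<rightarrow>\<^sup>*\<^bsub>with_proj G\<^esub> 0" using less by simp
      moreover have "(j, par j) \<in> parcs G" using False less.prems by (simp add: parcs_G_iff)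
      then have "j \<rightarrow>\<^sup>*\<^bsub>with_proj G\<^esub> par j" using reachable_adjI by simp
      ultimately show ?thesis by (meson reachable_trans)
    qed
  qed
  have "u \<rightarrow>\<^sup>*\<^bsub>with_proj G\<^esub> v" if "u < n" "v < n" for u v
    using root[OF that(1)] root[OF that(2)] symmetric_reachable[OF sym]
    by (meson reachable_trans)
  then have "strongly_connected (with_proj (mk_symmetric (with_proj G)))"
    using order_pos by (intro strongly_connectedI reachable_mk_symmetricI) auto
  then show ?thesis by (simp add: Digraph_Component.connected_def)
qed

text \<open>
  The largest vertex of a cycle can only be adjacent to its parent within the cycle, so
  its predecessor and its successor coincide; this leaves only cycles of length at most two.
\<close>

lemma acyclic_G:
  assumes "pre_digraph.cycle (with_proj G) w"
  shows "length w < 3"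
proof (rule ccontr)
  assume "\<not> length w < 3"
  then have L: "3 \<le> length w" by simp
  interpret pair_graph G by (rule pair_graph_G)
  obtain u where u: "awalk u w u" "distinct (tl (pawalk_verts u w))"
    using assms by (auto simp: cycle_def)
  have w: "pcas u w u" "set w \<subseteq> parcs G" "w \<noteq> []" using u(1) L by (auto simp: awalk_def)
  have "tl (pawalk_verts u w) = map snd w"
    using awalk_verts_conv'[OF w(1)] w(3) by simp
  with u(2) have dist: "distinct (map snd w)" by simp
  define x where "x = Max (set (map snd w))"
  have "x \<in> set (map snd w)" unfolding x_def using w(3) by (intro Max_in) auto
  then obtain i where i: "i < length w" "snd (w ! i) = x"
    by (metis in_set_conv_nth length_map nth_map)
  \<comment> \<open>Arc \<open>i\<close> enters \<open>x\<close>; cyclically, \<open>h\<close> is the arc before it and \<open>j\<close> the arc after it,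
    so that \<open>h\<close> and \<open>j\<close> end in the two neighbours of \<open>x\<close> on the cycle.\<close>
  define h where "h = (i + length w - 1) mod length w"
  define j where "j = Suc i mod length w"
  have hj: "h < length w" "j < length w" using w(3) by (simp_all add: h_def j_def)
  have h_eq: "h = (if i = 0 then length w - 1 else i - 1)"
    using i(1) L by (auto simp: h_def mod_if)
  have j_eq: "j = (if Suc i = length w then 0 else Suc i)"
    using i(1) by (auto simp: j_def)
  have Suc_h: "Suc h mod length w = i" using i(1) L by (auto simp: h_eq)
  have pred: "w ! i = (snd (w ! h), x)"
    using pcas_closed_nth[OF w(1) hj(1)] i(2) Suc_h
    by (intro prod_eqI) simp_all
  have succ: "w ! j = (x, snd (w ! j))"
    using pcas_closed_nth[OF w(1) i(1)] i(2) by (intro prod_eqI) (simp_all add: j_def)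
  have le: "snd (w ! k) \<le> x" if "k < length w" for k
    unfolding x_def using that by (intro Max_ge) auto
  have parent: "y = par x" if "(x, y) \<in> parcs G \<or> (y, x) \<in> parcs G" and "y \<le> x" for y
    using that parent_less[of y] unfolding parcs_G_iff by (metis linorder_not_less)
  have "(snd (w ! h), x) \<in> parcs G"
    unfolding pred[symmetric] using nth_mem[OF i(1)] w(2) by blast
  then have "snd (w ! h) = par x" using parent le[OF hj(1)] by blast
  moreover have "(x, snd (w ! j)) \<in> parcs G"
    unfolding succ[symmetric] using nth_mem[OF hj(2)] w(2) by blast
  then have "snd (w ! j) = par x" using parent le[OF hj(2)] by blast
  ultimately have "h = j"
    using nth_eq_iff_index_eq[OF dist, of h j] hj by simp
  then show False using L i(1) by (auto simp: h_eq j_eq split: if_splits)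
qed

lemma undirected_tree_G: "undirected_tree G"
  using pair_graph_G connected_G acyclic_G by (force simp: undirected_tree_def)

lemma edges_G: "edges G = (\<lambda>j. {j, par j}) ` {0<..<n}"
proof (intro set_eqI iffI)
  fix e assume "e \<in> (\<lambda>j. {j, par j}) ` {0<..<n}"
  then obtain j where "e = {j, par j}" "(j, par j) \<in> parcs G" by (auto simp: parcs_G_iff)
  then show "e \<in> edges G" unfolding edges_def by blast
qed (auto simp: edges_def parcs_G_iff insert_commute)

lemma inj_on_parent_edge: "inj_on (\<lambda>j. {j, par j}) {0<..<n}"
proof (rule inj_onI)
  fix i j assume "i \<in> {0<..<n}" "j \<in> {0<..<n}" "{i, par i} = {j, par j}"
  then show "i = j"
    using parent_less[of i] parent_less[of j]
    by (metis doubleton_eq_iff greaterThanLessThan_iff less_asym)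
qed

lemma graph_order_G: "graph_order G = n"
  by (simp add: graph_order_def)

lemma graph_size_G: "graph_size G = n - 1"
  by (simp add: graph_size_def edges_G card_image[OF inj_on_parent_edge])

lemma degree_G: "degree G v = card {j \<in> {0<..<n}. v = j \<or> v = par j}"
proof -
  have "{e \<in> edges G. v \<in> e} = (\<lambda>j. {j, par j}) ` {j \<in> {0<..<n}. v = j \<or> v = par j}"
    by (auto simp: edges_G)
  moreover have "inj_on (\<lambda>j. {j, par j}) {j \<in> {0<..<n}. v = j \<or> v = par j}"
    by (rule inj_on_subset[OF inj_on_parent_edge]) auto
  ultimately show ?thesis
    by (simp only: degree_def card_image)
qed

end

section \<open>Spiders with additional leaves on one leg\<close>

text \<open>
  Vertex \<open>0\<close> is the centre, \<open>1, \<dots>, r\<close> are the middle vertices, and the leaves are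
  \<open>r + 1, \<dots>, 2r + t\<close>. The last \<open>t\<close> leaves are the additional ones, all attached to the middle
  vertex \<open>1\<close>.
\<close>

definition spider_parent :: "nat \<Rightarrow> nat \<Rightarrow> nat" where
  "spider_parent r j = (if j \<le> r then 0 else if j \<le> 2 * r then j - r else 1)"

locale spider =
  fixes r t :: nat
  assumes legs: "4 \<le> r"
begin

sublocale parent_function "Suc (2 * r + t)" "spider_parent r"
  using legs by unfold_locales (auto simp: spider_parent_def)

definition "leaves = {r<..2 * r + t}"

definition "S = insert 0 leaves"

lemma finite_leaves [simp]: "finite leaves" and card_leaves: "card leaves = r + t"
  by (simp_all add: leaves_def)

lemma zero_notin_leaves [simp]: "0 \<notin> leaves"
  by (simp add: leaves_def)

lemma card_S: "card S = r + t + 1"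
  by (simp add: S_def card_leaves)

lemma degree_centre: "degree G 0 = r"
proof -
  have "{j \<in> {0<..<Suc (2 * r + t)}. 0 = j \<or> 0 = spider_parent r j} = {0<..r}"
    by (auto simp: spider_parent_def split: if_splits)
  then show ?thesis by (simp add: degree_G)
qed

lemma degree_leaf:
  assumes "v \<in> leaves"
  shows "degree G v = 1"
proof -
  have "{j \<in> {0<..<Suc (2 * r + t)}. v = j \<or> v = spider_parent r j} = {v}"
    using assms legs by (auto simp: leaves_def spider_parent_def split: if_splits)
  then show ?thesis by (simp add: degree_G)
qed

lemma degree_middle:
  assumes "2 \<le> v" and "v \<le> r"
  shows "degree G v = 2"
proof -
  have "{j \<in> {0<..<Suc (2 * r + t)}. v = j \<or> v = spider_parent r j} = {v, r + v}"
    using assms by (auto simp: spider_parent_def split: if_splits)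
  then show ?thesis using assms by (simp add: degree_G)
qed

lemma degree_pos:
  assumes "0 < v" and "v < Suc (2 * r + t)"
  shows "0 < degree G v"
  unfolding degree_G using assms by (auto simp: card_gt_0_iff)

lemma degree_sum_leaves: "degree_sum G leaves = r + t"
  by (simp add: degree_sum_def degree_leaf card_leaves)

lemma independent_S: "independent_set G S"
  using legs
  by (auto simp: independent_set_def S_def leaves_def parcs_G_iff spider_parent_def)

lemma maximal_annihilating_S: "maximal_annihilating_set G S"
proof -
  have sum_S: "degree_sum G S = 2 * r + t"
    using degree_sum_leaves by (simp add: S_def degree_sum_def degree_centre)
  moreover have "degree_sum G S < degree_sum G (S \<union> {v})" if "v \<in> pverts G - S" for v
  proof -
    have "0 < v" using that by (auto simp: S_def intro: gr0I)
    then have "0 < degree G v" using that by (intro degree_pos) auto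
    then show ?thesis using that by (simp add: degree_sum_def S_def)
  qed
  moreover have "S \<subseteq> pverts G" using independent_S by (simp add: independent_set_def)
  ultimately show ?thesis
    by (simp add: maximal_annihilating_set_def annihilating_set_def graph_size_G)
qed

text \<open>
  Replace the set \<open>B\<close> of middle vertices of an independent set \<open>A\<close> by their private leaves
  \<open>r + i\<close>. The result lies in \<open>S\<close> and has the size of \<open>A\<close>; if \<open>B\<close> is nonempty, it misses
  the centre.
\<close>

lemma independent_card_less:
  assumes "independent_set G A" and "A \<noteq> S"
  shows "card A < card S"
proof -
  define B where "B = A \<inter> {1..r}"
  have A: "A \<subseteq> {..<Suc (2 * r + t)}"
    and indep: "\<And>u v. u \<in> A \<Longrightarrow> v \<in> A \<Longrightarrow> (u, v) \<notin> parcs G"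
    using assms(1) by (auto simp: independent_set_def)
  have fin: "finite A" using A finite_subset by blast
  have split: "A - B \<subseteq> S" using A by (auto simp: B_def S_def leaves_def)
  show ?thesis
  proof (cases "B = {}")
    case True
    with split assms(2) have "A \<subset> S" by auto
    then show ?thesis by (intro psubset_card_mono) (auto simp: S_def)
  next
    case False
    let ?C = "(+) r ` B"
    have C: "?C \<subseteq> leaves" by (auto simp: B_def leaves_def)
    have "r + i \<notin> A" if "i \<in> B" for i
      using indep[of i "r + i"] that by (auto simp: B_def parcs_G_iff spider_parent_def)
    then have disj: "(A - B) \<inter> ?C = {}" by auto
    obtain i where "i \<in> B" using False by blast
    then have "0 \<notin> A"
      using indep[of 0 i] by (auto simp: B_def parcs_G_iff spider_parent_def)
    then have "(A - B) \<union> ?C \<subseteq> leaves" using split C by (auto simp: S_def)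
    then have "card ((A - B) \<union> ?C) \<le> r + t"
      using card_mono[OF finite_leaves] card_leaves by metis
    moreover have "card ((A - B) \<union> ?C) = card A"
    proof -
      have "finite B" "B \<subseteq> A" using fin by (auto simp: B_def)
      then show ?thesis
        using disj fin
        by (simp add: card_Un_disjoint card_image card_Diff_subset card_mono)
    qed
    ultimately show ?thesis by (simp add: card_S)
  qed
qed

lemma spider_max_independent: "max_independent_sets G = {S}"
  using independent_card_less independent_S
  by (auto simp: max_independent_sets_def) (metis less_imp_le_nat order_refl linorder_not_less)+

text \<open>Two middle vertices of degree \<open>2\<close> are at most as expensive as the centre, which
  has degree \<open>r\<close>.\<close>

lemma annihilation_number_spider: "r + t + 2 \<le> annihilation_number G"
proof -
  let ?A = "insert 2 (insert 3 leaves)"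
  have out: "2 \<notin> leaves" "3 \<notin> leaves" using legs by (auto simp: leaves_def)
  then have "degree_sum G ?A = r + t + 4"
    using degree_sum_leaves legs by (simp add: degree_sum_def degree_middle)
  then have "annihilating_set G ?A"
    using legs by (auto simp: annihilating_set_def graph_size_G leaves_def)
  from annihilating_set_card_le[OF _ this] show ?thesis
    using out by (simp add: card_leaves)
qed

lemma spider_properties:
  "undirected_tree G" "graph_order G = Suc (2 * r + t)"
  "real (graph_order G) / 2 \<le> real (annihilation_number G)"
  "\<forall>A \<in> max_independent_sets G.
     maximal_annihilating_set G A \<and> \<not> maximum_annihilating_set G A"
  using undirected_tree_G graph_order_G annihilation_number_spider maximal_annihilating_S card_S
  by (auto simp: spider_max_independent maximum_annihilating_set_def)

end

theorem theorem3p2: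
  shows "(\<forall>k::nat. k \<ge> 4 \<longrightarrow>
            (\<exists>T :: nat pair_pre_digraph.
               undirected_tree T \<and> graph_order T = 2 * k + 1 \<and>
               real (annihilation_number T) \<ge> real (graph_order T) / 2 \<and>
               (\<forall>S \<in> max_independent_sets T.
                  maximal_annihilating_set T S \<and> \<not> maximum_annihilating_set T S)))
       \<and> (\<forall>k::nat. k \<ge> 3 \<longrightarrow>
            (\<exists>T :: nat pair_pre_digraph.
               undirected_tree T \<and> graph_order T = 2 * k + 4 \<and>
               real (annihilation_number T) \<ge> real (graph_order T) / 2 \<and>
               (\<forall>S \<in> max_independent_sets T.
                  maximal_annihilating_set T S \<and> \<not> maximum_annihilating_set T S)))"
proof (intro conjI allI impI)
  fix k :: nat assume "k \<ge> 4"
  then interpret spider k 0 by unfold_locales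
  show "\<exists>T :: nat pair_pre_digraph.
      undirected_tree T \<and> graph_order T = 2 * k + 1 \<and>
      real (annihilation_number T) \<ge> real (graph_order T) / 2 \<and>
      (\<forall>S \<in> max_independent_sets T.
         maximal_annihilating_set T S \<and> \<not> maximum_annihilating_set T S)"
    using spider_properties by (intro exI[of _ G]) simp
next
  fix k :: nat assume "k \<ge> 3"
  then interpret spider "k + 1" 1 by unfold_locales simp
  show "\<exists>T :: nat pair_pre_digraph.
      undirected_tree T \<and> graph_order T = 2 * k + 4 \<and>
      real (annihilation_number T) \<ge> real (graph_order T) / 2 \<and>
      (\<forall>S \<in> max_independent_sets T.
         maximal_annihilating_set T S \<and> \<not> maximum_annihilating_set T S)"
    using spider_properties by (intro exI[of _ G]) simp
qed

end
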